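(* Let $K_4-P_3$ denote the graph obtained from $K_4$ by deleting the edges of a path on three vertices (equivalently, a triangle with one pendant edge attached to one of its vertices). Then $$\pi_{K_4-P_3}(\mathcal{T}_4)=4-2\sqrt3 .$$
   Context: Graphs are finite and simple. Let $H$ be a host graph. A (weighted) $H$-partite graph is a graph $G$ together with a canonical partition $V(G)=\bigsqcup_{x\in V(H)}V_x$ and a weight function $w:V(G)\to[0,1]$ such that (1) $\sum_{v\in V_x}w(v)=1$ for each $x\in V(H)$; (2) every edge of $G$ joins a vertex of $V_x$ to a vertex of $V_y$ for some $xy\in E(H)$. For $xy\in E(H)$ put $\alpha_{xy}:=\sum_{u\in V_x,\,v\in V_y}w(u)w(v)\mathbb{1}_{uv\in E(G)}$; the $H$-partite density of $G$ is $d_H(G):=\min\{\alpha_{xy}: xy\in E(H)\}$. A transversal of $G$ is a subgraph of $G$ induced by a set of vertices meeting each part $V_x$ in exactly one vertex (it is naturally viewed as a spanning subgraph of $H$). For a family $\mathcal{F}$ of graphs, $G$ has $\mathcal{F}$-free transversals if no transversal of $G$ contains a member of $\mathcal{F}$ as a subgraph, and $$\pi_H(\mathcal{F}):=\sup\{d_H(G): G\text{ is an }H\text{-partite graph with }\mathcal{F}\text{-free transversals}\}.$$ $\mathcal{T}_4$ denotes the family of all trees on $4$ vertices; thus for a $4$-vertex host graph $H$, $G$ has $\mathcal{T}_4$-free transversals if and only if no transversal of $G$ is connected. *)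

theory Defs
  imports Complex_Main "Graph_Theory.Graph_Theory"
begin

text \<open>
  Finite simple graphs are modelled as \<^locale>\<open>pair_graph\<close>: the arc relation \<^const>\<open>parcs\<close> is
  finite, symmetric and irreflexive, so that an edge \<open>uv\<close> is the pair of arcs \<open>(u, v)\<close>, \<open>(v, u)\<close>.
\<close>

text \<open>
  The library notions of forest and tree count \<open>u, v, u\<close> as a cycle (or else look at
  directed cycles only), so they are not the undirected ones. A cycle of a simple graph is a
  cycle of the symmetric digraph of length at least 3.
\<close>

definition acyclic_graph :: "'a pair_pre_digraph \<Rightarrow> bool" where
  "acyclic_graph G \<longleftrightarrow> (\<nexists>p. pre_digraph.cycle (with_proj G) p \<and> 3 \<le> length p)"

definition tree_graph :: "'a pair_pre_digraph \<Rightarrow> bool" where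
  "tree_graph G \<longleftrightarrow> pair_graph G \<and> Digraph_Component.connected (with_proj G) \<and> acyclic_graph G"

definition trees4 :: "nat pair_pre_digraph set" where
  "trees4 = {T. tree_graph T \<and> card (pverts T) = 4}"

definition contains_graph :: "'a pair_pre_digraph \<Rightarrow> 'b pair_pre_digraph \<Rightarrow> bool" where
  "contains_graph G F \<longleftrightarrow>
     (\<exists>S. subgraph (with_proj S) (with_proj G) \<and> digraph_iso (with_proj F) (with_proj S))"

text \<open>\<open>V x\<close> is the part of the canonical partition belonging to the vertex \<open>x\<close> of the host.\<close>

locale partite_graph = H: pair_graph H + G: pair_graph G
  for H :: "'h pair_pre_digraph" and G :: "'a pair_pre_digraph" +
  fixes V :: "'h \<Rightarrow> 'a set" and w :: "'a \<Rightarrow> real"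
  assumes parts_cover: "pverts G = (\<Union>x\<in>pverts H. V x)"
    and parts_disjoint: "\<And>x y. x \<in> pverts H \<Longrightarrow> y \<in> pverts H \<Longrightarrow> x \<noteq> y \<Longrightarrow> V x \<inter> V y = {}"
    and weight_range: "\<And>v. v \<in> pverts G \<Longrightarrow> 0 \<le> w v \<and> w v \<le> 1"
    and weight_sum: "\<And>x. x \<in> pverts H \<Longrightarrow> (\<Sum>v\<in>V x. w v) = 1"
    and arcs_between_parts:
      "\<And>u v. (u, v) \<in> parcs G \<Longrightarrow> \<exists>(x, y)\<in>parcs H. u \<in> V x \<and> v \<in> V y"

definition pair_density ::
    "'a pair_pre_digraph \<Rightarrow> ('h \<Rightarrow> 'a set) \<Rightarrow> ('a \<Rightarrow> real) \<Rightarrow> 'h \<Rightarrow> 'h \<Rightarrow> real" where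
  "pair_density G V w x y = (\<Sum>u\<in>V x. \<Sum>v\<in>V y. w u * w v * of_bool ((u, v) \<in> parcs G))"

definition partite_density ::
    "'h pair_pre_digraph \<Rightarrow> 'a pair_pre_digraph \<Rightarrow> ('h \<Rightarrow> 'a set) \<Rightarrow> ('a \<Rightarrow> real) \<Rightarrow> real" where
  "partite_density H G V w = Min {pair_density G V w x y | x y. (x, y) \<in> parcs H}"

definition transversal ::
    "'h pair_pre_digraph \<Rightarrow> 'a pair_pre_digraph \<Rightarrow> ('h \<Rightarrow> 'a set) \<Rightarrow> 'a pair_pre_digraph \<Rightarrow> bool" where
  "transversal H G V T \<longleftrightarrow>
     induced_subgraph (with_proj T) (with_proj G) \<and> (\<forall>x\<in>pverts H. \<exists>!v. v \<in> pverts T \<inter> V x)"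

definition free_transversals ::
    "'h pair_pre_digraph \<Rightarrow> 'f pair_pre_digraph set \<Rightarrow> 'a pair_pre_digraph \<Rightarrow> ('h \<Rightarrow> 'a set) \<Rightarrow> bool"
  where
  "free_transversals H \<F> G V \<longleftrightarrow>
     (\<forall>T. transversal H G V T \<longrightarrow> \<not> (\<exists>F\<in>\<F>. contains_graph T F))"

text \<open>
  The graphs \<open>G\<close> range over graphs with vertices in \<^typ>\<open>nat\<close>, which up to isomorphism are all
  finite graphs.
\<close>

definition partite_turan_density ::
    "'h pair_pre_digraph \<Rightarrow> 'f pair_pre_digraph set \<Rightarrow> real" where
  "partite_turan_density H \<F> =
     Sup {partite_density H G V w | (G :: nat pair_pre_digraph) V w.
            partite_graph H G V w \<and> free_transversals H \<F> G V}"

text \<open>The deleted path on three vertices is \<open>1, 0, 2\<close>.\<close>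

definition K4_minus_P3 :: "nat pair_pre_digraph" where
  "K4_minus_P3 = \<lparr> pverts = {0, 1, 2, 3},
     parcs = {(x, y). x \<in> {0, 1, 2, 3} \<and> y \<in> {0, 1, 2, 3} \<and> x \<noteq> y}
             - {(1, 0), (0, 1), (0, 2), (2, 0)} \<rparr>"

end

theory Submission
  imports Defs
begin

text \<open>
  Write \<open>E\<close> for the edges of \<open>G\<close>. A transversal \<open>v\<^sub>0, v\<^sub>1, v\<^sub>2, v\<^sub>3\<close> is connected exactly if
  \<open>v\<^sub>0v\<^sub>3 \<in> E\<close> (the pendant edge) and at least two of the triangle edges \<open>v\<^sub>1v\<^sub>2, v\<^sub>1v\<^sub>3, v\<^sub>2v\<^sub>3\<close> are
  present. So all that matters about part 0 is the set \<open>A \<subseteq> V\<^sub>3\<close> of vertices having some neighbour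
  there.

  Upper bound. Let all densities be at least \<open>d\<close>. Then \<open>a = w(A) \<ge> d\<close>. No vertex of \<open>A\<close> has
  neighbours in both \<open>V\<^sub>1\<close> and \<open>V\<^sub>2\<close>, so the vertices of \<open>A\<close> with neighbours in \<open>V\<^sub>1\<close> and those with
  neighbours in \<open>V\<^sub>2\<close> have weights \<open>a\<^sub>1 + a\<^sub>2 \<le> a\<close>. Let \<open>b\<^sub>i\<close> be the weight of the neighbourhood of
  \<open>A\<close> in \<open>V\<^sub>i\<close>. The vertices of these two neighbourhoods are on no edge between \<open>V\<^sub>1\<close> and \<open>V\<^sub>2\<close>, so
  \<open>d \<le> (1 - b\<^sub>1)(1 - b\<^sub>2)\<close>, and the edges between \<open>V\<^sub>i\<close> and \<open>V\<^sub>3\<close> give \<open>d \<le> a\<^sub>ib\<^sub>i + (1 - a)\<close>. By the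
  inequality of arithmetic and geometric means these constraints force \<open>d \<le> 4 - 2\<surd>3\<close>
  (\<open>optimisation_bound\<close>).

  Lower bound. In the symmetric case of equality, \<open>a = d\<close>, \<open>a\<^sub>1 = a\<^sub>2 = d/2\<close> and
  \<open>b\<^sub>1 = b\<^sub>2 = 2 - \<surd>3\<close>. A graph on eight vertices realises these weights and makes all four
  densities equal to \<open>4 - 2\<surd>3\<close> (\<open>density_extremal\<close>, \<open>free_extremal\<close>), so the supremum is attained.
\<close>

section \<open>Trees and connectivity\<close>

text \<open>
  This cut criterion replaces walks: one direction refutes connectivity of a transversal by
  exhibiting a cut, the other proves connectivity of a tree built up leaf by leaf.
\<close>

lemma connected_iff_no_cut:
  assumes "pair_wf_digraph K"
  shows "Digraph_Component.connected (with_proj K) \<longleftrightarrow>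
    pverts K \<noteq> {} \<and>
    (\<forall>X\<subseteq>pverts K. X \<noteq> {} \<longrightarrow> (\<forall>(u, v)\<in>parcs K. u \<in> X \<longleftrightarrow> v \<in> X) \<longrightarrow> X = pverts K)"
    (is "_ \<longleftrightarrow> _ \<and> ?no_cut")
proof -
  interpret K: pair_wf_digraph K by fact
  let ?R = "rtrancl_on (pverts K) ((parcs K)\<^sup>s)"
  have conn: "Digraph_Component.connected (with_proj K) \<longleftrightarrow>
      pverts K \<noteq> {} \<and> (\<forall>u\<in>pverts K. \<forall>v\<in>pverts K. (u, v) \<in> ?R)"
    by (simp add: connected_conv)
  have closed: "v \<in> X" if "(u, v) \<in> ?R" "u \<in> X" "\<forall>(u, v)\<in>parcs K. u \<in> X \<longleftrightarrow> v \<in> X" for u v X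
    using that by (induct rule: rtrancl_on_induct) (auto simp: symcl_def)
  have no_cut: "?no_cut" if "\<forall>u\<in>pverts K. \<forall>v\<in>pverts K. (u, v) \<in> ?R"
  proof (intro allI impI)
    fix X assume X: "X \<subseteq> pverts K" "X \<noteq> {}" "\<forall>(u, v)\<in>parcs K. u \<in> X \<longleftrightarrow> v \<in> X"
    then obtain u where "u \<in> X" by blast
    then show "X = pverts K" using X that closed[of u _ X] by blast
  qed
  have linked: "(u, v) \<in> ?R" if ?no_cut "u \<in> pverts K" "v \<in> pverts K" for u v
  proof -
    let ?X = "{x. (u, x) \<in> ?R}"
    have "?X \<subseteq> pverts K" by (auto dest: in_rtrancl_on_in_F)
    moreover have "?X \<noteq> {}" using that(2) by auto
    moreover have "(u, x) \<in> ?R \<longleftrightarrow> (u, y) \<in> ?R" if "(x, y) \<in> parcs K" for x y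
    proof -
      have "(x, y) \<in> (parcs K)\<^sup>s" "(y, x) \<in> (parcs K)\<^sup>s" "x \<in> pverts K" "y \<in> pverts K"
        using that by (auto simp: symcl_def dest: K.wellformed')
      then show ?thesis by (meson rtrancl_on_into_rtrancl_on)
    qed
    ultimately have "?X = pverts K" using \<open>?no_cut\<close> by blast
    then show ?thesis using that(3) by blast
  qed
  show ?thesis
    unfolding conn
  proof (intro iffI conjI ballI; elim conjE)
    assume "\<forall>u\<in>pverts K. \<forall>v\<in>pverts K. (u, v) \<in> ?R"
    then show ?no_cut by (rule no_cut)
  next
    fix u v assume ?no_cut "u \<in> pverts K" "v \<in> pverts K"
    then show "(u, v) \<in> ?R" by (rule linked)
  qed assumption+
qed

lemma pcas_append:
  "pcas u (p @ q) v \<longleftrightarrow> (\<exists>x. pcas u p x \<and> pcas x q v)"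
  by (induct p arbitrary: u) auto

lemma pcas_last: "pcas u p v \<Longrightarrow> p \<noteq> [] \<Longrightarrow> v = snd (last p)"
  by (induct p arbitrary: u) (auto split: if_splits)

text \<open>
  A closed walk enters a leaf \<open>v\<close> from its only neighbour \<open>u\<close> and must go straight back to \<open>u\<close>.
  If anything of the walk remains after that, it ends at \<open>u\<close> again, so \<open>u\<close> is repeated. Cycles of
  length 2 really do pass through leaves, whence the bound on the length.
\<close>

lemma long_cycle_avoids_leaf:
  assumes cyc: "pre_digraph.cycle (with_proj G) p" "3 \<le> length p"
    and leaf: "\<And>x. (x, v) \<in> parcs G \<Longrightarrow> x = u" "\<And>x. (v, x) \<in> parcs G \<Longrightarrow> x = u"
    and e: "e \<in> set p"
  shows "fst e \<noteq> v \<and> snd e \<noteq> v"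
proof -
  interpret pair_pre_digraph G .
  from cyc obtain x where x: "pcas x p x" "set p \<subseteq> parcs G" "distinct (tl (pawalk_verts x p))"
    unfolding cycle_def awalk_def by auto
  have "pawalk_verts x p = (if p = [] then [x] else fst (hd p) # map snd p)"
    using awalk_verts_conv'[of x p x] x(1) by simp
  with x(3) cyc(2) have dist: "distinct (map snd p)" by (auto split: if_splits)
  \<comment> \<open>Rotating the cycle, any of its arcs may be taken as the first one.\<close>
  have rotated: "\<exists>q. pcas b q a \<and> q \<noteq> [] \<and> set q \<subseteq> set p \<and> 2 \<le> length q \<and> distinct (b # map snd q)"
    if "(a, b) \<in> set p" for a b
  proof -
    obtain p1 p2 where p: "p = p1 @ (a, b) # p2" using \<open>(a, b) \<in> set p\<close> by (meson split_list)
    have "pcas b (p2 @ p1) a" using x(1) unfolding p by (force simp: pcas_append simp del: cas_append_iff)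
    moreover have "distinct (b # map snd (p2 @ p1))" using dist unfolding p by auto
    moreover have "2 \<le> length (p2 @ p1)" using cyc(2) unfolding p by auto
    ultimately show ?thesis unfolding p by (intro exI[of _ "p2 @ p1"]) auto
  qed
  have no_head: False if "(a, v) \<in> set p" for a
  proof -
    from rotated[OF that] obtain q where q: "pcas v q a" "set q \<subseteq> set p" "2 \<le> length q"
      "distinct (v # map snd q)" by blast
    have a: "a = u" using that x(2) leaf(1) by auto
    obtain f r where qr: "q = f # r" using q(3) by (cases q) auto
    with q(3) have "r \<noteq> []" by auto
    have "f = (v, u)" using q(1,2) x(2) leaf(2) unfolding qr by (cases f) auto
    moreover have "a = snd (last r)" using q(1) \<open>r \<noteq> []\<close> pcas_last[of _ r a] unfolding qr by auto
    ultimately show False using q(4) a \<open>r \<noteq> []\<close> last_in_set[of r] unfolding qr by force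
  qed
  obtain a b where ab: "e = (a, b)" by (cases e)
  from rotated[of a b] e ab obtain q where "pcas b q a" "q \<noteq> []" "set q \<subseteq> set p" by blast
  then have "(fst (last q), a) \<in> set p" using pcas_last by (metis last_in_set prod.collapse subsetD)
  then show ?thesis using no_head e ab by auto
qed

definition add_leaf :: "'a pair_pre_digraph \<Rightarrow> 'a \<Rightarrow> 'a \<Rightarrow> 'a pair_pre_digraph" where
  "add_leaf G u v = \<lparr> pverts = insert v (pverts G), parcs = parcs G \<union> {(u, v), (v, u)} \<rparr>"

lemma add_leaf_simps [simp]:
  "pverts (add_leaf G u v) = insert v (pverts G)"
  "parcs (add_leaf G u v) = parcs G \<union> {(u, v), (v, u)}"
  by (simp_all add: add_leaf_def)

lemma pair_graphI:
  assumes "finite (pverts G)" "parcs G \<subseteq> pverts G \<times> pverts G" "sym (parcs G)" "irrefl (parcs G)"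
  shows "pair_graph G"
proof
  show "finite (pverts G)" by fact
  show "finite (parcs G)" using assms(1,2) by (meson finite_SigmaI finite_subset)
  show "symmetric (with_proj G)" using assms(3) by (simp add: symmetric_def)
  fix e assume e: "e \<in> parcs G"
  show "fst e \<in> pverts G" "snd e \<in> pverts G" using e assms(2) by (auto dest!: subsetD)
  show "fst e \<noteq> snd e" using e assms(4) by (cases e) (auto simp: irrefl_def)
qed

lemma tree_graph_singleton: "tree_graph \<lparr> pverts = {a}, parcs = {} \<rparr>"
proof -
  let ?G = "\<lparr> pverts = {a}, parcs = {} \<rparr>"
  have G: "pair_graph ?G" by (rule pair_graphI) (auto simp: irrefl_def sym_def)
  then interpret pair_graph ?G .
  have "Digraph_Component.connected (with_proj ?G)"
    by (subst connected_iff_no_cut) (auto simp: pair_wf_digraph)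
  moreover have "acyclic_graph ?G"
    by (auto simp: acyclic_graph_def cycle_def awalk_def)
  ultimately show ?thesis using G by (simp add: tree_graph_def)
qed

text \<open>
  A cut of the larger graph restricts to a cut of \<open>G\<close>, because the leaf lies on the same side as
  its neighbour; a cycle cannot use the leaf, hence is a cycle of \<open>G\<close>.
\<close>

lemma tree_graph_add_leaf:
  assumes tree: "tree_graph G" and u: "u \<in> pverts G" and v: "v \<notin> pverts G"
  shows "tree_graph (add_leaf G u v)"
proof -
  let ?L = "add_leaf G u v"
  interpret G: pair_graph G using tree by (simp add: tree_graph_def)
  have arcsG: "parcs G \<subseteq> pverts G \<times> pverts G" using G.wellformed' by auto
  have L: "pair_graph ?L"
  proof (rule pair_graphI)
    show "sym (parcs ?L)" using G.arcs_symmetric by (auto simp: sym_def)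
    show "irrefl (parcs ?L)" using G.no_loops' u v by (auto simp: irrefl_def)
    show "finite (pverts ?L)" using G.pair_finite_verts by simp
    show "parcs ?L \<subseteq> pverts ?L \<times> pverts ?L" using u arcsG by auto
  qed
  then interpret L: pair_graph ?L .
  have "Digraph_Component.connected (with_proj ?L)"
    unfolding connected_iff_no_cut[OF L.pair_wf_digraph]
  proof (intro conjI allI impI)
    fix X assume X: "X \<subseteq> pverts ?L" "X \<noteq> {}" "\<forall>(x, y)\<in>parcs ?L. x \<in> X \<longleftrightarrow> y \<in> X"
    have same: "x \<in> X \<longleftrightarrow> y \<in> X" if "(x, y) \<in> parcs ?L" for x y using bspec[OF X(3) that] by simp
    have uv: "u \<in> X \<longleftrightarrow> v \<in> X" by (rule same) simp
    then have ne: "X \<inter> pverts G \<noteq> {}" using X(1,2) u by auto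
    have "X \<inter> pverts G = pverts G"
    proof -
      have "\<forall>(x, y)\<in>parcs G. x \<in> X \<inter> pverts G \<longleftrightarrow> y \<in> X \<inter> pverts G"
        using same arcsG by fastforce
      moreover have "Digraph_Component.connected (with_proj G)"
        using tree by (simp add: tree_graph_def)
      ultimately show ?thesis
        using ne connected_iff_no_cut[OF G.pair_wf_digraph] by (metis Int_lower2)
    qed
    then show "X = pverts ?L" using uv u X(1) by auto
  qed auto
  moreover have "acyclic_graph ?L"
    unfolding acyclic_graph_def
  proof
    assume "\<exists>p. pre_digraph.cycle (with_proj ?L) p \<and> 3 \<le> length p"
    then obtain p where p: "pre_digraph.cycle (with_proj ?L) p" "3 \<le> length p" by blast
    have leaf: "x = u" if "(x, v) \<in> parcs ?L \<or> (v, x) \<in> parcs ?L" for x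
      using that subsetD[OF arcsG, of "(x, v)"] subsetD[OF arcsG, of "(v, x)"] v by force
    have avoid: "fst e \<noteq> v \<and> snd e \<noteq> v" if "e \<in> set p" for e
      by (rule long_cycle_avoids_leaf[OF p _ _ that]) (use leaf in blast)+
    obtain x where x: "pcas x p x" "distinct (tl (pawalk_verts x p))" "set p \<subseteq> parcs ?L" "p \<noteq> []"
      using p(1) unfolding L.cycle_def L.awalk_def by blast
    have sub: "set p \<subseteq> parcs G"
    proof
      fix e assume "e \<in> set p"
      then show "e \<in> parcs G" using subsetD[OF x(3), of e] avoid[of e] by auto
    qed
    obtain y q where q: "p = (x, y) # q" using x(1,4) by (cases p) auto
    then have "x \<in> pverts G" using subsetD[OF arcsG, of "(x, y)"] sub by simp
    then have "pre_digraph.cycle (with_proj G) p"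
      using x sub unfolding G.cycle_def G.awalk_def by blast
    then show False using tree p(2) unfolding tree_graph_def acyclic_graph_def by blast
  qed
  ultimately show ?thesis using L by (simp add: tree_graph_def)
qed

text \<open>
  The forbidden trees and the graphs \<open>G\<close> have vertices of the same type, so a tree found inside
  \<open>G\<close> is itself a forbidden one, isomorphic to itself through the identity.
\<close>

lemma contains_graph_subgraph:
  assumes "subgraph (with_proj S) (with_proj G)"
  shows "contains_graph G S"
proof -
  have "digraph_iso (with_proj S) (with_proj S)"
    unfolding digraph_iso_def
    by (rule exI[of _ "\<lparr>iso_verts = id, iso_arcs = id, iso_head = snd, iso_tail = fst\<rparr>"])
       (use assms in \<open>auto simp: pre_digraph.digraph_isomorphism_def app_iso_def with_proj_def
          subgraph_def\<close>)
  then show ?thesis using assms unfolding contains_graph_def by blast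
qed

lemma contains_spanning_tree_imp_connected:
  assumes fin: "finite (pverts T)" and card: "card (pverts T) = card (pverts F)"
    and conn: "Digraph_Component.connected (with_proj F)"
    and cont: "contains_graph T F"
  shows "Digraph_Component.connected (with_proj T)"
proof -
  from cont obtain S f where S: "subgraph (with_proj S) (with_proj T)"
    and f: "pre_digraph.digraph_isomorphism (with_proj F) f" "with_proj S = app_iso f (with_proj F)"
    by (auto simp: contains_graph_def digraph_iso_def)
  have ST: "pverts S \<subseteq> pverts T" "parcs S \<subseteq> parcs T" and wfS: "pair_wf_digraph S"
    and wfT: "pair_wf_digraph T"
    using S by (auto simp: subgraph_def wf_digraph_wp_iff)
  have "pverts S = iso_verts f ` pverts F" using f(2) by (metis app_iso_simps(1) with_proj_simps(1))
  then have "card (pverts S) = card (pverts T)"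
    using pre_digraph.digraph_isomorphism_inj_on_verts[OF f(1)] card by (simp add: card_image)
  then have verts: "pverts S = pverts T" using ST(1) fin by (meson card_subset_eq)
  have "Digraph_Component.connected (with_proj S)"
    using wf_digraph.connectedI_app_iso[OF _ conn f(1)] f
    by (simp add: pre_digraph.digraph_isomorphism_def)
  then show ?thesis
    using ST(2) unfolding connected_iff_no_cut[OF wfS] connected_iff_no_cut[OF wfT] verts by blast
qed

section \<open>Weight of edges between two sets\<close>

definition edge_weight :: "('a \<Rightarrow> real) \<Rightarrow> ('a \<times> 'a) set \<Rightarrow> 'a set \<Rightarrow> 'a set \<Rightarrow> real" where
  "edge_weight w E X Y = (\<Sum>u\<in>X. \<Sum>v\<in>Y. w u * w v * of_bool ((u, v) \<in> E))"

lemma pair_density_edge_weight: "pair_density G V w x y = edge_weight w (parcs G) (V x) (V y)"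
  by (simp add: pair_density_def edge_weight_def)

text \<open>
  All edges between \<open>X\<close> and \<open>Y\<close> lie in the rectangle \<open>C \<times> D\<close>, whose total weight factorises.
\<close>

lemma edge_weight_le_rectangle:
  assumes fin: "finite X" "finite Y" and sub: "C \<subseteq> X" "D \<subseteq> Y"
    and nonneg: "\<And>v. v \<in> X \<union> Y \<Longrightarrow> 0 \<le> w v"
    and E: "\<And>u v. u \<in> X \<Longrightarrow> v \<in> Y \<Longrightarrow> (u, v) \<in> E \<Longrightarrow> u \<in> C \<and> v \<in> D"
  shows "edge_weight w E X Y \<le> sum w C * sum w D"
proof -
  have "edge_weight w E X Y \<le> (\<Sum>u\<in>X. \<Sum>v\<in>Y. (w u * of_bool (u \<in> C)) * (w v * of_bool (v \<in> D)))"
    unfolding edge_weight_def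
    by (intro sum_mono) (use E nonneg in \<open>auto simp: of_bool_def\<close>)
  also have "\<dots> = (\<Sum>u\<in>X. w u * of_bool (u \<in> C)) * (\<Sum>v\<in>Y. w v * of_bool (v \<in> D))"
    by (simp add: sum_product)
  also have "(\<Sum>u\<in>X. w u * of_bool (u \<in> C)) = sum w C"
    using sub fin by (intro sum.mono_neutral_cong_right) auto
  also have "(\<Sum>v\<in>Y. w v * of_bool (v \<in> D)) = sum w D"
    using sub fin by (intro sum.mono_neutral_cong_right) auto
  finally show ?thesis .
qed

lemma edge_weight_split:
  assumes "finite Y" "A \<subseteq> Y"
  shows "edge_weight w E X Y = edge_weight w E X A + edge_weight w E X (Y - A)"
  unfolding edge_weight_def
  by (simp add: sum.distrib[symmetric] sum.subset_diff[OF assms(2,1)] add.commute)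

section \<open>The optimisation problem\<close>

text \<open>
  Put \<open>c = d - (1 - a)\<close>, so that \<open>a\<^sub>ib\<^sub>i \<ge> c\<close>, and \<open>t = 1 - (b\<^sub>1 + b\<^sub>2)/2\<close>. The inequality of means
  gives \<open>a(b\<^sub>1 + b\<^sub>2) \<ge> (a\<^sub>1 + a\<^sub>2)(b\<^sub>1 + b\<^sub>2) \<ge> 4c\<close>, which rearranges to an upper bound on
  \<open>a(2 + 2t)\<close>; as \<open>d \<le> a\<close>, this becomes \<open>d(3 + t) \<le> 2\<close>. Applied to \<open>1 - b\<^sub>1\<close> and \<open>1 - b\<^sub>2\<close> it also gives
  \<open>d \<le> t\<^sup>2\<close>. The first bound decreases in \<open>t\<close> and the second increases; they meet at \<open>t = \<surd>3 - 1\<close>,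
  where \<open>d = t\<^sup>2 = 4 - 2\<surd>3\<close>.
\<close>

lemma optimisation_bound:
  fixes a a\<^sub>1 a\<^sub>2 b\<^sub>1 b\<^sub>2 d :: real
  assumes nonneg: "0 \<le> a\<^sub>1" "0 \<le> a\<^sub>2" "0 \<le> b\<^sub>1" "0 \<le> b\<^sub>2"
    and le: "b\<^sub>1 \<le> 1" "b\<^sub>2 \<le> 1" "a\<^sub>1 + a\<^sub>2 \<le> a"
    and d: "d \<le> a" "d \<le> a\<^sub>1 * b\<^sub>1 + (1 - a)" "d \<le> a\<^sub>2 * b\<^sub>2 + (1 - a)" "d \<le> (1 - b\<^sub>1) * (1 - b\<^sub>2)"
  shows "d \<le> 4 - 2 * sqrt 3"
  \<comment> \<open>The inequality of means needs \<open>c \<ge> 0\<close>, which \<open>d > 1/2\<close> ensures.\<close>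
proof (cases "d \<le> 1 / 2")
  case True
  have "sqrt 3 \<le> 7 / 4" by (rule real_le_lsqrt) (auto simp: power2_eq_square)
  then show ?thesis using True by simp
next
  case False
  define c where "c = d - 1 + a"
  define t where "t = 1 - (b\<^sub>1 + b\<^sub>2) / 2"
  define r where "r = sqrt 3 - 1"
  have r: "0 < r" "r\<^sup>2 = 4 - 2 * sqrt 3" "r\<^sup>2 * (3 + r) = 2"
    by (auto simp: r_def power2_eq_square algebra_simps)
  have c: "0 < c" "c \<le> a\<^sub>1 * b\<^sub>1" "c \<le> a\<^sub>2 * b\<^sub>2" using False d by (auto simp: c_def)
  have t: "0 \<le> t" "t \<le> 1" using nonneg le by (auto simp: t_def)
  \<comment> \<open>The mixed terms have product at least \<open>c\<^sup>2\<close>, hence sum at least \<open>2c\<close>.\<close>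
  have amgm: "2 * c \<le> a\<^sub>1 * b\<^sub>2 + a\<^sub>2 * b\<^sub>1"
  proof (rule power2_le_imp_le)
    have "(2 * c)\<^sup>2 \<le> 4 * ((a\<^sub>1 * b\<^sub>1) * (a\<^sub>2 * b\<^sub>2))"
      using mult_mono[OF c(2,3)] c(1) nonneg by (simp add: power2_eq_square)
    also have "\<dots> = (a\<^sub>1 * b\<^sub>2 + a\<^sub>2 * b\<^sub>1)\<^sup>2 - (a\<^sub>1 * b\<^sub>2 - a\<^sub>2 * b\<^sub>1)\<^sup>2"
      by (simp add: power2_eq_square algebra_simps)
    also have "\<dots> \<le> (a\<^sub>1 * b\<^sub>2 + a\<^sub>2 * b\<^sub>1)\<^sup>2" by simp
    finally show "(2 * c)\<^sup>2 \<le> (a\<^sub>1 * b\<^sub>2 + a\<^sub>2 * b\<^sub>1)\<^sup>2" .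
  qed (use nonneg in simp)
  have "4 * c \<le> (a\<^sub>1 + a\<^sub>2) * (b\<^sub>1 + b\<^sub>2)" using amgm c by (simp add: algebra_simps)
  also have "\<dots> \<le> a * (b\<^sub>1 + b\<^sub>2)" using le nonneg by (intro mult_right_mono) auto
  also have "b\<^sub>1 + b\<^sub>2 = 2 - 2 * t" by (simp add: t_def)
  finally have "a * (2 + 2 * t) \<le> 4 * (1 - d)" by (simp add: c_def algebra_simps)
  moreover have "d * (2 + 2 * t) \<le> a * (2 + 2 * t)" using d(1) t by (intro mult_right_mono) auto
  ultimately have dt: "d * (3 + t) \<le> 2" by (simp add: algebra_simps)
  have "(1 - b\<^sub>1) * (1 - b\<^sub>2) = t\<^sup>2 - ((b\<^sub>1 - b\<^sub>2) / 2)\<^sup>2"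
    by (simp add: t_def power2_eq_square field_simps)
  then have d_t: "d \<le> t\<^sup>2" using d(4) by (smt (verit) zero_le_power2)
  show ?thesis
  proof (cases "t \<le> r")
    case True
    then have "t\<^sup>2 \<le> r\<^sup>2" using t by (intro power_mono) auto
    then show ?thesis using d_t r(2) by simp
  next
    case F: False
    have "d * (3 + r) \<le> d * (3 + t)" using F False by (intro mult_left_mono) auto
    then have "d * (3 + r) \<le> r\<^sup>2 * (3 + r)" using dt r(3) by simp
    then show ?thesis using r(1,2) by (simp add: mult_le_cancel_right)
  qed
qed

section \<open>The upper bound\<close>

lemma K4_minus_P3_verts [simp]: "pverts K4_minus_P3 = {0, 1, 2, 3}"
  by (simp add: K4_minus_P3_def)

text \<open>
  In this form the membership can be discharged by arithmetic on numerals.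
\<close>

lemma less_4_K4_minus_P3_verts: "i < 4 \<Longrightarrow> i \<in> pverts K4_minus_P3"
  unfolding K4_minus_P3_verts insert_iff by arith

lemma K4_minus_P3_arcs:
  "parcs K4_minus_P3 = {(0, 3), (3, 0), (1, 2), (2, 1), (1, 3), (3, 1), (2, 3), (3, 2)}"
  by (auto simp: K4_minus_P3_def)

lemma pair_graph_K4_minus_P3: "pair_graph K4_minus_P3"
  by (rule pair_graphI) (auto simp: K4_minus_P3_arcs sym_def irrefl_def)

lemma partite_density_le:
  assumes "finite (parcs H)" "(x, y) \<in> parcs H"
  shows "partite_density H G V w \<le> pair_density G V w x y"
proof -
  have "{pair_density G V w x y | x y. (x, y) \<in> parcs H}
      = (\<lambda>(x, y). pair_density G V w x y) ` parcs H" by auto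
  then show ?thesis unfolding partite_density_def using assms by (intro Min_le) auto
qed

text \<open>
  The transversal that violates freeness is the subgraph of \<open>G\<close> induced by the vertices of \<open>S\<close>.
\<close>

lemma free_transversals_no_tree:
  assumes part: "partite_graph H G V w" and free: "free_transversals H \<F> G V"
    and S: "S \<in> \<F>" "pair_wf_digraph S" "pverts S \<subseteq> pverts G" "parcs S \<subseteq> parcs G"
    and one: "\<And>x. x \<in> pverts H \<Longrightarrow> \<exists>!v. v \<in> pverts S \<inter> V x"
  shows False
proof -
  interpret partite_graph H G V w by fact
  define T where "T = \<lparr> pverts = pverts S, parcs = parcs G \<inter> pverts S \<times> pverts S \<rparr>"
  have T: "pverts T = pverts S" "parcs T = parcs G \<inter> pverts S \<times> pverts S" by (auto simp: T_def)
  have wfT: "pair_wf_digraph T" by unfold_locales (auto simp: T)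
  have "induced_subgraph (with_proj T) (with_proj G)"
    using S(3) wfT by (auto simp: induced_subgraph_def subgraph_def T wf_digraph_wp_iff compatible_def)
  then have "transversal H G V T" using one by (simp add: transversal_def T)
  moreover have "subgraph (with_proj S) (with_proj T)"
    using S wfT pair_wf_digraph.wellformed'[OF S(2)]
    by (auto simp: subgraph_def T wf_digraph_wp_iff compatible_def)
  then have "contains_graph T S" by (rule contains_graph_subgraph)
  ultimately show False using free S(1) by (auto simp: free_transversals_def)
qed

text \<open>
  Two edges of the triangle together with the pendant edge \<open>v\<^sub>0v\<^sub>3\<close> form a spanning tree of the
  transversal: a star in the first case, a path in the other two.
\<close>

lemma no_spanning_tree:
  fixes G :: "nat pair_pre_digraph"
  assumes part: "partite_graph K4_minus_P3 G V w"
    and free: "free_transversals K4_minus_P3 trees4 G V"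
    and v: "v\<^sub>0 \<in> V 0" "v\<^sub>1 \<in> V 1" "v\<^sub>2 \<in> V 2" "v\<^sub>3 \<in> V 3"
    and e: "(v\<^sub>0, v\<^sub>3) \<in> parcs G"
  shows "\<not> ((v\<^sub>1, v\<^sub>3) \<in> parcs G \<and> (v\<^sub>2, v\<^sub>3) \<in> parcs G)"
    and "\<not> ((v\<^sub>1, v\<^sub>3) \<in> parcs G \<and> (v\<^sub>1, v\<^sub>2) \<in> parcs G)"
    and "\<not> ((v\<^sub>2, v\<^sub>3) \<in> parcs G \<and> (v\<^sub>1, v\<^sub>2) \<in> parcs G)"
proof -
  interpret partite_graph K4_minus_P3 G V w by fact
  have disj: "V i \<inter> V j = {}" if "i < 4" "j < 4" "i \<noteq> j" for i j
    using parts_disjoint[of i j] that less_4_K4_minus_P3_verts by blast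
  note disjs = disj[of 0 1] disj[of 0 2] disj[of 0 3] disj[of 1 2] disj[of 1 3] disj[of 2 3]
  have other: "v\<^sub>1 \<notin> V 0" "v\<^sub>2 \<notin> V 0" "v\<^sub>3 \<notin> V 0" "v\<^sub>0 \<notin> V 1" "v\<^sub>2 \<notin> V 1" "v\<^sub>3 \<notin> V 1"
      "v\<^sub>0 \<notin> V 2" "v\<^sub>1 \<notin> V 2" "v\<^sub>3 \<notin> V 2" "v\<^sub>0 \<notin> V 3" "v\<^sub>1 \<notin> V 3" "v\<^sub>2 \<notin> V 3"
    by (use v disjs in auto)
  then have dist: "v\<^sub>0 \<noteq> v\<^sub>1" "v\<^sub>0 \<noteq> v\<^sub>2" "v\<^sub>0 \<noteq> v\<^sub>3" "v\<^sub>1 \<noteq> v\<^sub>2" "v\<^sub>1 \<noteq> v\<^sub>3" "v\<^sub>2 \<noteq> v\<^sub>3"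
    using v by blast+
  have VG: "{v\<^sub>0, v\<^sub>1, v\<^sub>2, v\<^sub>3} \<subseteq> pverts G" using v unfolding parts_cover by auto
  have one: "\<exists>!v. v \<in> {v\<^sub>0, v\<^sub>1, v\<^sub>2, v\<^sub>3} \<inter> V x" if x: "x \<in> pverts K4_minus_P3" for x
  proof -
    consider "x = 0" | "x = 1" | "x = 2" | "x = 3" using x unfolding K4_minus_P3_verts by blast
    then show ?thesis
    proof cases
      case 1 show ?thesis unfolding 1 by (rule ex1I[of _ v\<^sub>0]) (use v(1) other(1-3) in blast)+
    next
      case 2 show ?thesis unfolding 2 by (rule ex1I[of _ v\<^sub>1]) (use v(2) other(4-6) in blast)+
    next
      case 3 show ?thesis unfolding 3 by (rule ex1I[of _ v\<^sub>2]) (use v(3) other(7-9) in blast)+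
    next
      case 4 show ?thesis unfolding 4 by (rule ex1I[of _ v\<^sub>3]) (use v(4) other(10-12) in blast)+
    qed
  qed
  note sym = G.arcs_symmetric
  have no_tree: False
    if x: "(v\<^sub>3, x) \<in> parcs G" and yz: "(y, z) \<in> parcs G" "y = v\<^sub>3 \<or> y = x"
      and xz: "{x, z} = {v\<^sub>1, v\<^sub>2}" for x y z
  proof -
    \<comment> \<open>Start at \<open>v\<^sub>3\<close>, hang \<open>v\<^sub>0\<close> and \<open>x\<close> on it, and then \<open>z\<close> on \<open>v\<^sub>3\<close> or \<open>x\<close>.\<close>
    let ?S = "add_leaf (add_leaf (add_leaf \<lparr> pverts = {v\<^sub>3}, parcs = {} \<rparr> v\<^sub>3 v\<^sub>0) v\<^sub>3 x) y z"
    have d: "x \<noteq> z" "x \<noteq> v\<^sub>0" "x \<noteq> v\<^sub>3" "z \<noteq> v\<^sub>0" "z \<noteq> v\<^sub>3"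
      using xz dist unfolding doubleton_eq_iff by blast+
    have tree: "tree_graph ?S"
      by (intro tree_graph_add_leaf tree_graph_singleton) (use d dist(3) yz(2) in auto)
    have verts: "pverts ?S = {v\<^sub>0, v\<^sub>1, v\<^sub>2, v\<^sub>3}"
      using xz by (simp add: insert_commute doubleton_eq_iff) (elim disjE conjE; simp add: insert_commute)
    show False
    proof (rule free_transversals_no_tree[OF part free])
      show "?S \<in> trees4" using tree verts dist unfolding trees4_def by simp
      show "pair_wf_digraph ?S"
        using tree unfolding tree_graph_def by (blast intro: pair_digraph.pair_wf_digraph pair_graph.axioms(1))
      show "pverts ?S \<subseteq> pverts G" using verts VG by simp
      show "parcs ?S \<subseteq> parcs G" using x yz(1) e sym by simp
      show "\<exists>!v. v \<in> pverts ?S \<inter> V u" if "u \<in> pverts K4_minus_P3" for u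
        unfolding verts by (rule one[OF that])
    qed
  qed
  show "\<not> ((v\<^sub>1, v\<^sub>3) \<in> parcs G \<and> (v\<^sub>2, v\<^sub>3) \<in> parcs G)"
    using no_tree[of v\<^sub>1 v\<^sub>3 v\<^sub>2] sym by blast
  show "\<not> ((v\<^sub>1, v\<^sub>3) \<in> parcs G \<and> (v\<^sub>1, v\<^sub>2) \<in> parcs G)"
    using no_tree[of v\<^sub>1 v\<^sub>1 v\<^sub>2] sym by blast
  show "\<not> ((v\<^sub>2, v\<^sub>3) \<in> parcs G \<and> (v\<^sub>1, v\<^sub>2) \<in> parcs G)"
    using no_tree[of v\<^sub>2 v\<^sub>2 v\<^sub>1] sym by blast
qed

lemma partite_density_upper_bound:
  fixes G :: "nat pair_pre_digraph"
  assumes part: "partite_graph K4_minus_P3 G V w"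
    and free: "free_transversals K4_minus_P3 trees4 G V"
  shows "partite_density K4_minus_P3 G V w \<le> 4 - 2 * sqrt 3"
proof -
  interpret partite_graph K4_minus_P3 G V w by fact
  let ?E = "parcs G" and ?d = "partite_density K4_minus_P3 G V w"
  note no_tree = no_spanning_tree[OF part free]
  have sub: "V i \<subseteq> pverts G" if "i < 4" for i
    using parts_cover less_4_K4_minus_P3_verts[OF that] by blast
  have fin: "finite (V i)" if "i < 4" for i
    using finite_subset[OF sub[OF that] G.pair_finite_verts] .
  have w0: "0 \<le> w v" if "v \<in> V i" "i < 4" for i v using weight_range sub that by blast
  have w1: "sum w (V i) = 1" if "i < 4" for i
    using weight_sum[OF less_4_K4_minus_P3_verts[OF that]] .
  have sum_nonneg_sub: "0 \<le> sum w X" "sum w X \<le> 1" "sum w (V i - X) = 1 - sum w X"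
    if "X \<subseteq> V i" "i < 4" for X i
  proof -
    show "0 \<le> sum w X" using that w0 by (intro sum_nonneg) blast
    show d: "sum w (V i - X) = 1 - sum w X"
      using sum_diff[OF fin[OF that(2)] that(1), of w] w1[OF that(2)] by simp
    have "0 \<le> sum w (V i - X)" using that w0 by (intro sum_nonneg) blast
    then show "sum w X \<le> 1" using d by simp
  qed
  \<comment> \<open>Only the vertices of \<open>A\<close> impose constraints on the triangle; their neighbours in parts 1
    and 2 are the sets \<open>B 1\<close>, \<open>B 2\<close>, reached from \<open>A' 1\<close>, \<open>A' 2\<close>.\<close>
  define A where "A = {z \<in> V 3. \<exists>u\<in>V 0. (u, z) \<in> ?E}"
  define A' where "A' i = {z \<in> A. \<exists>u\<in>V i. (u, z) \<in> ?E}" for i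
  define B where "B i = {u \<in> V i. \<exists>z\<in>A. (u, z) \<in> ?E}" for i
  have subs: "A \<subseteq> V 3" "A' i \<subseteq> A" "A' i \<subseteq> V 3" "B i \<subseteq> V i" for i
    by (auto simp: A_def A'_def B_def)
  have dens: "?d \<le> edge_weight w ?E (V x) (V y)" if "(x, y) \<in> parcs K4_minus_P3" for x y
    using partite_density_le[OF _ that, of G V w] H.pair_finite_arcs
    by (simp add: pair_density_edge_weight)
  have "?d \<le> sum w (V 0) * sum w A"
    by (rule order_trans[OF dens[of 0 3] edge_weight_le_rectangle])
      (use fin[of 0] fin[of 3] w0[of _ 0] w0[of _ 3] in \<open>auto simp: K4_minus_P3_arcs A_def\<close>)
  then have d03: "?d \<le> sum w A" using w1 by simp
  have finA: "finite A" using finite_subset[OF subs(1) fin] by simp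
  \<comment> \<open>Vertices outside \<open>A\<close> may be joined to the whole of part \<open>i\<close>, so they count with their full weight.\<close>
  have to3: "?d \<le> sum w (A' i) * sum w (B i) + (1 - sum w A)" if i: "i \<in> {1, 2}" for i
  proof -
    have i4: "i < 4" using i by auto
    note w0s = w0[OF _ i4] w0[of _ 3]
    have "?d \<le> edge_weight w ?E (V i) (V 3)" using i by (intro dens) (auto simp: K4_minus_P3_arcs)
    also have "\<dots> = edge_weight w ?E (V i) A + edge_weight w ?E (V i) (V 3 - A)"
      by (rule edge_weight_split) (use fin[of 3] subs(1) in auto)
    also have "edge_weight w ?E (V i) A \<le> sum w (B i) * sum w (A' i)"
    proof (rule edge_weight_le_rectangle)
      show "u \<in> B i \<and> v \<in> A' i" if "u \<in> V i" "v \<in> A" "(u, v) \<in> ?E" for u v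
        using that by (auto simp: A'_def B_def)
    qed (use fin[OF i4] finA subs w0s in auto)
    also have "edge_weight w ?E (V i) (V 3 - A) \<le> sum w (V i) * sum w (V 3 - A)"
      by (rule edge_weight_le_rectangle) (use fin[OF i4] fin[of 3] w0s in auto)
    also have "\<dots> = 1 - sum w A" using w1[OF i4] sum_nonneg_sub(3)[OF subs(1)] by simp
    finally show ?thesis by (simp add: mult.commute)
  qed
  \<comment> \<open>An edge between parts 1 and 2 that meets \<open>B 1\<close> or \<open>B 2\<close> would complete a path.\<close>
  have "?d \<le> sum w (V 1 - B 1) * sum w (V 2 - B 2)"
  proof (rule order_trans[OF dens[of 1 2] edge_weight_le_rectangle])
    fix u v assume "u \<in> V 1" "v \<in> V 2" "(u, v) \<in> ?E"
    then show "u \<in> V 1 - B 1 \<and> v \<in> V 2 - B 2"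
      using no_tree(2,3)[of _ u v] by (auto simp: B_def A_def)
  qed (use fin[of 1] fin[of 2] w0[of _ 1] w0[of _ 2] in \<open>auto simp: K4_minus_P3_arcs\<close>)
  then have d12: "?d \<le> (1 - sum w (B 1)) * (1 - sum w (B 2))"
    using sum_nonneg_sub(3)[OF subs(4)] by simp
  have "A' 1 \<inter> A' 2 = {}" using no_tree(1) unfolding A'_def A_def by blast
  then have "sum w (A' 1) + sum w (A' 2) = sum w (A' 1 \<union> A' 2)"
    using finite_subset[OF subs(2) finA] by (simp add: sum.union_disjoint)
  also have "\<dots> \<le> sum w A" by (rule sum_mono2) (use finA subs(1,2) w0[of _ 3] in auto)
  finally have a12: "sum w (A' 1) + sum w (A' 2) \<le> sum w A" .
  show ?thesis
    by (rule optimisation_bound[OF _ _ _ _ _ _ a12 d03 _ _ d12])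
      (use to3 sum_nonneg_sub(1)[OF subs(3)] sum_nonneg_sub(1,2)[OF subs(4)] in auto)
qed

section \<open>The extremal graph\<close>

text \<open>
  In part 3 the vertices 5 and 6 play the role of \<open>A\<close>: both are joined to part 0, and 5 sees only
  vertex 1 of part 1, 6 only vertex 3 of part 2. Vertices 1 and 3 therefore have no edge between
  parts 1 and 2, which leaves only 2--4. Vertex 7 is not joined to part 0 and may be joined to
  all of parts 1 and 2.
\<close>

definition extremal_edges :: "(nat \<times> nat) set" where
  "extremal_edges = {(0, 5), (0, 6), (1, 5), (3, 6), (2, 4), (1, 7), (2, 7), (3, 7), (4, 7)}"

definition extremal_graph :: "nat pair_pre_digraph" where
  "extremal_graph = \<lparr> pverts = {0, 1, 2, 3, 4, 5, 6, 7}, parcs = extremal_edges \<union> extremal_edges\<inverse> \<rparr>"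

definition extremal_part :: "nat \<Rightarrow> nat set" where
  "extremal_part x = [{0}, {1, 2}, {3, 4}, {5, 6, 7}] ! x"

text \<open>
  With \<open>d = 4 - 2\<surd>3\<close>, the vertices 5 and 6 weigh \<open>d/2\<close> each and 7 weighs \<open>1 - d\<close>. The common
  weight \<open>2 - \<surd>3\<close> of 1 and 3 solves \<open>(1 - b)\<^sup>2 = d\<close>.
\<close>

definition extremal_weight :: "nat \<Rightarrow> real" where
  "extremal_weight v = [1, 2 - sqrt 3, sqrt 3 - 1, 2 - sqrt 3, sqrt 3 - 1,
     2 - sqrt 3, 2 - sqrt 3, 2 * sqrt 3 - 3] ! v"

lemma extremal_arcs: "parcs extremal_graph = extremal_edges \<union> extremal_edges\<inverse>"
  and extremal_verts: "pverts extremal_graph = {0, 1, 2, 3, 4, 5, 6, 7}"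
  by (simp_all add: extremal_graph_def)

lemma extremal_part_simps [simp]:
  "extremal_part 0 = {0}" "extremal_part (Suc 0) = {1, 2}" "extremal_part 2 = {3, 4}"
  "extremal_part 3 = {5, 6, 7}"
  by (simp_all add: extremal_part_def numeral_eq_Suc)

lemma extremal_weight_simps [simp]:
  "extremal_weight 0 = 1" "extremal_weight (Suc 0) = 2 - sqrt 3" "extremal_weight 2 = sqrt 3 - 1"
  "extremal_weight 3 = 2 - sqrt 3" "extremal_weight 4 = sqrt 3 - 1" "extremal_weight 5 = 2 - sqrt 3"
  "extremal_weight 6 = 2 - sqrt 3" "extremal_weight 7 = 2 * sqrt 3 - 3"
  by (simp_all add: extremal_weight_def eval_nat_numeral)

lemma pair_graph_extremal: "pair_graph extremal_graph"
proof (rule pair_graphI)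
  show "sym (parcs extremal_graph)" by (simp add: extremal_arcs sym_Un_converse)
  show "irrefl (parcs extremal_graph)"
    by (rule irreflI) (auto simp: extremal_arcs extremal_edges_def)
  have "extremal_edges \<subseteq> pverts extremal_graph \<times> pverts extremal_graph"
    by (simp add: extremal_edges_def extremal_verts)
  then show "parcs extremal_graph \<subseteq> pverts extremal_graph \<times> pverts extremal_graph"
    unfolding extremal_arcs by blast
qed (simp add: extremal_verts)

lemma partite_extremal: "partite_graph K4_minus_P3 extremal_graph extremal_part extremal_weight"
proof -
  have s: "3 / 2 \<le> sqrt 3" "sqrt 3 \<le> 2"
    by (rule real_le_rsqrt real_le_lsqrt; simp add: power2_eq_square)+
  show ?thesis
  proof (intro partite_graph.intro partite_graph_axioms.intro pair_graph_K4_minus_P3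
      pair_graph_extremal)
    show "0 \<le> extremal_weight v \<and> extremal_weight v \<le> 1" if "v \<in> pverts extremal_graph" for v
      using that s by (auto simp: extremal_verts)
    show "\<exists>(x, y)\<in>parcs K4_minus_P3. u \<in> extremal_part x \<and> v \<in> extremal_part y"
      if "(u, v) \<in> parcs extremal_graph" for u v
      using that by (auto simp: extremal_arcs extremal_edges_def K4_minus_P3_arcs)
  qed (auto simp: extremal_verts)
qed

lemma density_extremal:
  "partite_density K4_minus_P3 extremal_graph extremal_part extremal_weight = 4 - 2 * sqrt 3"
proof -
  have "\<forall>(x, y)\<in>parcs K4_minus_P3.
      pair_density extremal_graph extremal_part extremal_weight x y = 4 - 2 * sqrt 3"
    \<comment> \<open>The sums are expanded before the edge set: inside a sum over a bound vertex the edge set would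
      unfold to large disjunctions.\<close>
    apply (simp add: K4_minus_P3_arcs pair_density_def)
    apply (simp add: extremal_arcs extremal_edges_def)
    apply (simp add: algebra_simps)
    done
  then have "{pair_density extremal_graph extremal_part extremal_weight x y | x y.
      (x, y) \<in> parcs K4_minus_P3} = {4 - 2 * sqrt 3}"
    using K4_minus_P3_arcs by (blast intro: sym)
  then show ?thesis by (simp add: partite_density_def)
qed

text \<open>
  Once the vertex \<open>z\<close> of part 3 is chosen, the component of vertex 0 in what remains is confined to
  \<open>X\<close>, and \<open>X\<close> misses part 1 or part 2 altogether. The extremal edges are listed with the vertex of
  part 3 in second place.
\<close>

lemma extremal_cut:
  assumes "z \<in> {5, 6, 7}"
  obtains X where "0 \<in> X" "{3, 4} \<inter> X = {} \<or> {1, 2} \<inter> X = {}"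
    "\<And>x y. (x, y) \<in> extremal_edges \<Longrightarrow> y \<in> {5, 6, 7} \<longrightarrow> y = z \<Longrightarrow> x \<in> X \<longleftrightarrow> y \<in> X"
proof -
  consider "z = 5" | "z = 6" | "z = 7" using assms by blast
  then show thesis
  proof cases
    case 1
    show thesis by (rule that[of "{0, 1, 5}"]) (auto simp: 1 extremal_edges_def)
  next
    case 2
    show thesis by (rule that[of "{0, 3, 6}"]) (auto simp: 2 extremal_edges_def)
  next
    case 3
    show thesis by (rule that[of "{0}"]) (auto simp: 3 extremal_edges_def)
  qed
qed

lemma extremal_transversal_disconnected:
  assumes "transversal K4_minus_P3 extremal_graph extremal_part T"
  shows "card (pverts T) = 4" "\<not> Digraph_Component.connected (with_proj T)"
proof -
  have ind: "induced_subgraph (with_proj T) (with_proj extremal_graph)"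
    and one: "\<And>x. x \<in> {0, 1, 2, 3} \<Longrightarrow> \<exists>!v. v \<in> pverts T \<inter> extremal_part x"
    using assms unfolding transversal_def K4_minus_P3_verts by blast+
  have one_el: "\<exists>v. pverts T \<inter> extremal_part x = {v}" if "x \<in> {0, 1, 2, 3}" for x
    using one[OF that] by blast
  have wf: "pair_wf_digraph T" and arcs: "parcs T \<subseteq> parcs extremal_graph"
      and verts: "pverts T \<subseteq> pverts extremal_graph"
    using ind by (auto simp: induced_subgraph_def subgraph_def wf_digraph_wp_iff)
  have arcsT: "parcs T \<subseteq> pverts T \<times> pverts T" using pair_wf_digraph.wellformed'[OF wf] by fast
  obtain v\<^sub>1 v\<^sub>2 v\<^sub>3 where v: "v\<^sub>1 \<in> {1, 2}" "v\<^sub>2 \<in> {3, 4}" "v\<^sub>3 \<in> {5, 6, 7}"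
    "pverts T = {0, v\<^sub>1, v\<^sub>2, v\<^sub>3}"
  proof -
    obtain v\<^sub>0 v\<^sub>1 v\<^sub>2 v\<^sub>3 where t: "pverts T \<inter> {0} = {v\<^sub>0}" "pverts T \<inter> {1, 2} = {v\<^sub>1}"
      "pverts T \<inter> {3, 4} = {v\<^sub>2}" "pverts T \<inter> {5, 6, 7} = {v\<^sub>3}"
      using one_el[of 0] one_el[of 1] one_el[of 2] one_el[of 3] by auto
    moreover have "pverts T = pverts T \<inter> {0} \<union> pverts T \<inter> {1, 2} \<union> pverts T \<inter> {3, 4}
        \<union> pverts T \<inter> {5, 6, 7}"
      using verts unfolding extremal_verts by blast
    ultimately have "pverts T = {v\<^sub>0} \<union> {v\<^sub>1} \<union> {v\<^sub>2} \<union> {v\<^sub>3}" by simp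
    moreover have "v\<^sub>0 = 0" "v\<^sub>1 \<in> {1, 2}" "v\<^sub>2 \<in> {3, 4}" "v\<^sub>3 \<in> {5, 6, 7}" using t by blast+
    ultimately show thesis using that by blast
  qed
  show "card (pverts T) = 4" using v(1-3) unfolding v(4) by auto
  show "\<not> Digraph_Component.connected (with_proj T)"
  proof
    assume "Digraph_Component.connected (with_proj T)"
    then have no_cut: "\<forall>X\<subseteq>pverts T. X \<noteq> {} \<longrightarrow> (\<forall>(x, y)\<in>parcs T. x \<in> X \<longleftrightarrow> y \<in> X) \<longrightarrow> X = pverts T"
      unfolding connected_iff_no_cut[OF wf] by (rule conjunct2)
    obtain X where X: "0 \<in> X" "{3, 4} \<inter> X = {} \<or> {1, 2} \<inter> X = {}"
      "\<And>x y. (x, y) \<in> extremal_edges \<Longrightarrow> y \<in> {5, 6, 7} \<longrightarrow> y = v\<^sub>3 \<Longrightarrow> x \<in> X \<longleftrightarrow> y \<in> X"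
      using extremal_cut[OF v(3)] by blast
    have only: "y \<in> {5, 6, 7} \<longrightarrow> y = v\<^sub>3" if "y \<in> pverts T" for y
      using that v(1,2) unfolding v(4) by auto
    have "x \<in> X \<longleftrightarrow> y \<in> X" if "(x, y) \<in> parcs T" for x y
    proof -
      have xy: "x \<in> pverts T" "y \<in> pverts T" "(x, y) \<in> parcs extremal_graph"
        using that arcs arcsT by blast+
      then have "(x, y) \<in> extremal_edges \<or> (y, x) \<in> extremal_edges" by (simp add: extremal_arcs)
      then show ?thesis using X(3) only xy(1,2) by metis
    qed
    then have "\<forall>(x, y)\<in>parcs T. x \<in> pverts T \<inter> X \<longleftrightarrow> y \<in> pverts T \<inter> X" using arcsT by blast
    moreover have "0 \<in> pverts T \<inter> X" using v(4) X(1) by blast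
    ultimately have "pverts T \<inter> X = pverts T" using no_cut by (metis Int_lower1 empty_iff)
    then have "v\<^sub>1 \<in> X" "v\<^sub>2 \<in> X" using v(4) by blast+
    then show False using X(2) v(1,2) by blast
  qed
qed

lemma free_extremal:
  "free_transversals K4_minus_P3 trees4 extremal_graph extremal_part"
  unfolding free_transversals_def
proof (intro allI impI notI)
  fix T assume T: "transversal K4_minus_P3 extremal_graph extremal_part T"
    and "\<exists>F\<in>trees4. contains_graph T F"
  then obtain F where F: "F \<in> trees4" "contains_graph T F" by blast
  have "Digraph_Component.connected (with_proj T)"
    by (rule contains_spanning_tree_imp_connected[OF _ _ _ F(2)])
      (use F(1) extremal_transversal_disconnected(1)[OF T] card.infinite[of "pverts T"] in
        \<open>auto simp: trees4_def tree_graph_def\<close>)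
  then show False using extremal_transversal_disconnected(2)[OF T] by simp
qed

theorem proposition5p1:
  shows "partite_turan_density K4_minus_P3 trees4 = 4 - 2 * sqrt 3"
  unfolding partite_turan_density_def
proof (rule cSup_eq_maximum)
  show "4 - 2 * sqrt 3 \<in> {partite_density K4_minus_P3 G V w | (G :: nat pair_pre_digraph) V w.
      partite_graph K4_minus_P3 G V w \<and> free_transversals K4_minus_P3 trees4 G V}"
    using partite_extremal free_extremal density_extremal[symmetric] by blast
qed (use partite_density_upper_bound in blast)

end
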